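(* Let $G$ be a finite simple undirected graph on $n$ vertices and let $k$ be an integer with $2 \leq k \leq n$ such that $G$ is $k$-ordered. Then $c(G) \geq \min\{n, 2k\}$.
   Context: $G$ is $k$-ordered if for every sequence $(v_1, \ldots, v_k)$ of $k$ distinct vertices of $G$ there is a cycle of $G$ containing $v_1, \ldots, v_k$ in that cyclic order (possibly together with other vertices). The circumference $c(G)$ is the length of a longest cycle in $G$. *)

theory Defs
  imports "Graph_Theory.Graph_Theory" "HOL-Library.Sublist"
begin

text \<open>
  Finite simple undirected graphs are \<^locale>\<open>pair_graph\<close>s: each edge is represented by its two
  opposite arcs.  The library's notion of cycle therefore also admits the closed walk
  \<open>u, v, u\<close> along a single edge; requiring length at least 3 excludes exactly these.
\<close>

definition graph_cycle :: "'a pair_pre_digraph \<Rightarrow> ('a \<times> 'a) awalk \<Rightarrow> bool" where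
  "graph_cycle G p \<longleftrightarrow> pre_digraph.cycle (with_proj G) p \<and> 3 \<le> length p"

text \<open>The list \<open>map fst p\<close> runs once through the vertices of \<open>p\<close>, without repeating the base point.\<close>

definition visits_in_cyclic_order :: "('a \<times> 'a) awalk \<Rightarrow> 'a list \<Rightarrow> bool" where
  "visits_in_cyclic_order p vs \<longleftrightarrow> (\<exists>m. subseq vs (rotate m (map fst p)))"

definition k_ordered :: "nat \<Rightarrow> 'a pair_pre_digraph \<Rightarrow> bool" where
  "k_ordered k G \<longleftrightarrow>
     (\<forall>vs. length vs = k \<and> distinct vs \<and> set vs \<subseteq> pverts G \<longrightarrow>
        (\<exists>p. graph_cycle G p \<and> visits_in_cyclic_order p vs))"

text \<open>
  The maximum is over a finite set for every finite graph (see below).  It is meaningful only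
  if the graph has a cycle; its value is unspecified for acyclic graphs.
\<close>

definition circumference :: "'a pair_pre_digraph \<Rightarrow> nat" where
  "circumference G = Max {length p | p. graph_cycle G p}"

lemma finite_graph_cycle_lengths:
  assumes "pair_graph G"
  shows "finite {length p | p. graph_cycle G p}"
proof -
  interpret pair_graph G by fact
  have "length p \<le> card (parcs G)" if "graph_cycle G p" for p
  proof -
    have "distinct p" "set p \<subseteq> parcs G"
      using that unfolding graph_cycle_def cycle_conv awalk_def by auto
    then show ?thesis
      by (metis card_mono distinct_card pair_finite_arcs)
  qed
  then have "{length p | p. graph_cycle G p} \<subseteq> {..card (parcs G)}"
    by auto
  then show ?thesis
    by (rule finite_subset) simp
qed

end

theory Submission
  imports Defs
begin

text \<open>
  The argument is that of Chvatal and Erdos.  In a \<open>k\<close>-ordered graph, the segment from \<open>x\<close> to \<open>y\<close> of a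
  cycle through \<open>x, y, a\<^sub>1, \<dots>, a\<^sub>k\<^sub>-\<^sub>2\<close> in this order avoids all the \<open>a\<^sub>i\<close>, so deleting at
  most \<open>k - 2\<close> vertices does not disconnect the graph.  Suppose a longest cycle \<open>C\<close> misses a vertex \<open>x\<close>,
  and let \<open>D\<close> be the component of \<open>x\<close> in \<open>G - C\<close>.  The set \<open>A\<close> of neighbours of \<open>D\<close> on \<open>C\<close> separates
  \<open>D\<close> from the rest of \<open>C\<close>, hence has at least \<open>k - 1\<close> elements.  As \<open>C\<close> is longest, \<open>x\<close> together
  with the successors on \<open>C\<close> of the elements of \<open>A\<close> is independent.  A cycle through \<open>k\<close>
  independent vertices has length at least \<open>2 * k\<close>.
\<close>

section \<open>Cycles as lists of vertices\<close>

text \<open>The base point is not repeated, so a cycle can be rotated, and its segments reversed and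
  reassembled, as plain lists.\<close>

definition vertex_cycle :: "('a \<Rightarrow> 'a \<Rightarrow> bool) \<Rightarrow> 'a list \<Rightarrow> bool" where
  "vertex_cycle E xs \<longleftrightarrow>
     distinct xs \<and> 3 \<le> length xs \<and> successively E xs \<and> E (last xs) (hd xs)"

lemma vertex_cycle_rotate1: "vertex_cycle E xs \<Longrightarrow> vertex_cycle E (rotate1 xs)"
  by (cases xs; cases "tl xs"; cases "tl (tl xs)")
    (auto simp: vertex_cycle_def successively_append_iff successively_Cons split: if_splits)

lemma vertex_cycle_rotate: "vertex_cycle E xs \<Longrightarrow> vertex_cycle E (rotate m xs)"
  by (induction m) (auto simp: vertex_cycle_rotate1)

lemma vertex_cycle_nth:
  assumes "vertex_cycle E xs" "i < length xs"
  shows "E (xs ! i) (xs ! (Suc i mod length xs))"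
proof (cases "Suc i < length xs")
  case True
  then show ?thesis
    using assms by (auto simp: vertex_cycle_def successively_conv_nth)
next
  case False
  then have "length xs = Suc i" "xs \<noteq> []"
    using assms by auto
  then show ?thesis
    using assms by (auto simp: vertex_cycle_def last_conv_nth hd_conv_nth)
qed

lemma inj_on_Suc_mod: "inj_on (\<lambda>i. Suc i mod n) {..<n}"
  by (auto simp: inj_on_def mod_Suc split: if_splits)

text \<open>The positions of \<open>I\<close> and their shift by one are disjoint, since consecutive
  vertices are adjacent, and the shift is injective.\<close>

lemma independent_in_vertex_cycle:
  assumes cyc: "vertex_cycle E xs"
    and sub: "I \<subseteq> set xs" and indep: "pairwise (\<lambda>u v. \<not> E u v) I"
  shows "2 * card I \<le> length xs"
proof -
  let ?L = "length xs"
  define J where "J = {i. i < ?L \<and> xs ! i \<in> I}"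
  define f where "f i = Suc i mod ?L" for i
  have dist: "distinct xs" and len: "3 \<le> ?L"
    using cyc by (auto simp: vertex_cycle_def)
  have fJ: "finite J" "J \<subseteq> {..<?L}"
    by (auto simp: J_def)
  have "I = (!) xs ` J"
    using sub by (auto simp: J_def in_set_conv_nth image_iff) (metis in_set_conv_nth subsetD)
  then have "card I \<le> card J"
    using card_image_le fJ by blast
  have "inj_on f J"
    unfolding f_def using inj_on_Suc_mod fJ(2) by (rule inj_on_subset)
  then have card_f: "card (f ` J) = card J"
    by (rule card_image)
  have "J \<inter> f ` J = {}"
  proof (rule ccontr)
    assume "J \<inter> f ` J \<noteq> {}"
    then obtain i where i: "i \<in> J" "f i \<in> J"
      by blast
    then have "i < ?L" "f i < ?L"
      by (auto simp: J_def)
    \<comment> \<open>\<open>pairwise\<close> is silent about a vertex paired with itself; the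
      length bound makes the successor a different vertex.\<close>
    moreover have "f i \<noteq> i"
      using \<open>i < ?L\<close> len by (auto simp: f_def mod_Suc)
    ultimately have "xs ! i \<noteq> xs ! f i"
      using dist by (simp add: nth_eq_iff_index_eq)
    then have "\<not> E (xs ! i) (xs ! f i)"
      using indep i by (auto simp: pairwise_def J_def)
    then show False
      using vertex_cycle_nth[OF cyc \<open>i < ?L\<close>] by (simp add: f_def)
  qed
  then have "card J + card J = card (J \<union> f ` J)"
    using card_f fJ by (simp add: card_Un_disjoint)
  also have "\<dots> \<le> card {..<?L}"
    using fJ by (intro card_mono) (auto simp: f_def J_def intro!: mod_less_divisor)
  finally show ?thesis
    using \<open>card I \<le> card J\<close> by simp
qed

text \<open>Rotating by \<open>Suc i\<close> cuts the cycle open just after position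
  \<open>i\<close>: it becomes a path from the successor of \<open>xs ! i\<close> to
  \<open>xs ! i\<close>.\<close>

lemma last_hd_rotate_Suc:
  assumes "i < length xs"
  shows "last (rotate (Suc i) xs) = xs ! i"
    and "hd (rotate (Suc i) xs) = xs ! (Suc i mod length xs)"
proof -
  have ne: "xs \<noteq> []"
    using assms by auto
  then have "last (rotate (Suc i) xs) = rotate (Suc i) xs ! (length xs - 1)"
    by (subst last_conv_nth) auto
  also have "\<dots> = xs ! ((Suc i + (length xs - 1)) mod length xs)"
    using ne by (subst nth_rotate) auto
  also have "Suc i + (length xs - 1) = i + length xs"
    using ne by (cases xs) auto
  finally show "last (rotate (Suc i) xs) = xs ! i"
    using assms by simp
  show "hd (rotate (Suc i) xs) = xs ! (Suc i mod length xs)"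
    using ne by (metis hd_rotate_conv_nth)
qed

text \<open>The cycle is cut after position \<open>i\<close> and again after position
  \<open>j\<close>; \<open>i \<noteq> j\<close> keeps the second piece nonempty.\<close>

lemma rotate_split_at:
  assumes "distinct xs" "i < length xs" "j < length xs" "i \<noteq> j"
  obtains ys zs where "rotate (Suc i) xs = ys @ zs" "ys \<noteq> []" "zs \<noteq> []"
    "last ys = xs ! j" "hd zs = xs ! (Suc j mod length xs)"
proof -
  let ?r = "rotate (Suc i) xs" and ?L = "length xs"
  have "xs ! j \<in> set ?r"
    using assms by simp
  then obtain t where t: "t < ?L" "?r ! t = xs ! j"
    unfolding in_set_conv_nth by auto
  have eq: "(Suc i + t) mod ?L = j"
  proof -
    have "xs ! ((Suc i + t) mod ?L) = xs ! j"
      using t nth_rotate[of t xs "Suc i"] by simp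
    then show ?thesis
      using assms by (subst (asm) nth_eq_iff_index_eq) (auto intro!: mod_less_divisor)
  qed
  have "Suc t \<noteq> ?L"
  proof
    assume "Suc t = ?L"
    then have "Suc i + t = i + ?L" by simp
    then have "(Suc i + t) mod ?L = i"
      using assms(2) by (metis mod_add_self2 mod_less)
    with eq assms(4) show False by simp
  qed
  with t have t': "Suc t < ?L" by simp
  show thesis
  proof (rule that)
    show "?r = take (Suc t) ?r @ drop (Suc t) ?r" by simp
    show "take (Suc t) ?r \<noteq> []" "drop (Suc t) ?r \<noteq> []"
      using t' by auto
    show "last (take (Suc t) ?r) = xs ! j"
      using t by (subst take_Suc_conv_app_nth) auto
    have "hd (drop (Suc t) ?r) = ?r ! Suc t"
      using t' by (subst hd_drop_conv_nth) auto
    also have "\<dots> = xs ! ((Suc i + Suc t) mod ?L)"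
      using t' by (subst nth_rotate) auto
    also have "(Suc i + Suc t) mod ?L = Suc j mod ?L"
      using mod_Suc_eq[of "Suc i + t" ?L] unfolding eq by simp
    finally show "hd (drop (Suc t) ?r) = xs ! (Suc j mod ?L)" .
  qed
qed

section \<open>Paths and longest cycles\<close>

text \<open>When a new first vertex already lies on the path, only the suffix starting at it is
  kept.\<close>

lemma rtranclp_imp_path:
  assumes "R\<^sup>*\<^sup>* x y"
  shows "\<exists>xs. xs \<noteq> [] \<and> distinct xs \<and> successively R xs \<and> hd xs = x \<and> last xs = y"
  using assms
proof (induction rule: converse_rtranclp_induct)
  case base
  show ?case by (rule exI[of _ "[y]"]) simp
next
  case (step x z)
  then obtain xs where xs: "xs \<noteq> []" "distinct xs" "successively R xs" "hd xs = z" "last xs = y"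
    by blast
  show ?case
  proof (cases "x \<in> set xs")
    case True
    then obtain us vs where "xs = us @ x # vs"
      by (meson split_list)
    with xs show ?thesis
      by (intro exI[of _ "x # vs"]) (auto simp: successively_append_iff)
  next
    case False
    with xs step.hyps show ?thesis
      by (intro exI[of _ "x # xs"]) (auto simp: successively_Cons)
  qed
qed

lemma successively_imp_rtranclp:
  "successively R (x # xs) \<Longrightarrow> R\<^sup>*\<^sup>* x (last (x # xs))"
proof (induction xs arbitrary: x)
  case (Cons z zs)
  then have "R x z" "R\<^sup>*\<^sup>* z (last (z # zs))"
    by auto
  then show ?case
    by (simp add: converse_rtranclp_into_rtranclp)
qed simp

section \<open>Components off a longest cycle and their attachments\<close>

locale longest_cycle =
  fixes E :: "'a \<Rightarrow> 'a \<Rightarrow> bool" and cs :: "'a list"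
  assumes sym: "E u v \<Longrightarrow> E v u"
    and cycle: "vertex_cycle E cs"
    and longest: "vertex_cycle E ds \<Longrightarrow> length ds \<le> length cs"
begin

text \<open>The list \<open>xs\<close> may reorder the vertices of \<open>cs\<close>, and its ends
  need not be adjacent: the detour \<open>ps\<close> closes it to a longer cycle.\<close>

lemma no_longer_cycle:
  assumes "distinct (xs @ ps)" "successively E xs" "successively E ps" "ps \<noteq> []"
    and "length xs = length cs" "E (last xs) (hd ps)" "E (last ps) (hd xs)"
  shows False
proof -
  have "xs \<noteq> []" "3 \<le> length xs"
    using assms cycle by (auto simp: vertex_cycle_def)
  then have "vertex_cycle E (xs @ ps)"
    using assms by (auto simp: vertex_cycle_def successively_append_iff)
  from longest[OF this] show False
    using assms by simp
qed

text \<open>For \<open>x\<close> outside \<open>cs\<close> this is the component D of the overview,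
  and \<open>attach x\<close> is the set A.\<close>

definition off :: "'a \<Rightarrow> 'a set" where
  "off x = {v. (\<lambda>u v. E u v \<and> v \<notin> set cs)\<^sup>*\<^sup>* x v}"

definition attach :: "'a \<Rightarrow> 'a set" where
  "attach x = {a \<in> set cs. \<exists>d\<in>off x. E a d}"

lemma start_in_off: "x \<in> off x"
  by (simp add: off_def)

lemma off_step: "d \<in> off x \<Longrightarrow> E d v \<Longrightarrow> v \<notin> set cs \<Longrightarrow> v \<in> off x"
  by (auto simp: off_def intro: rtranclp.rtrancl_into_rtrancl)

lemma off_disjoint:
  assumes "x \<notin> set cs"
  shows "off x \<inter> set cs = {}"
proof -
  have "v \<notin> set cs" if "(\<lambda>u v. E u v \<and> v \<notin> set cs)\<^sup>*\<^sup>* x v" for v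
    using that assms by (induction rule: rtranclp_induct) auto
  then show ?thesis
    by (auto simp: off_def)
qed

lemma off_path:
  assumes "d \<in> off x" "d' \<in> off x"
  obtains ps where "ps \<noteq> []" "distinct ps" "successively E ps" "hd ps = d" "last ps = d'"
    "set ps \<subseteq> off x"
proof -
  \<comment> \<open>The relation that defines \<open>off\<close> tests only the vertex entered.
    Testing both ends makes it symmetric, so \<open>d\<close> and \<open>d'\<close> are joined
    through \<open>x\<close>.\<close>
  let ?R = "\<lambda>u v. E u v \<and> u \<in> off x \<and> v \<in> off x"
  have reach: "?R\<^sup>*\<^sup>* x v" if "v \<in> off x" for v
  proof -
    have "(\<lambda>u v. E u v \<and> v \<notin> set cs)\<^sup>*\<^sup>* x v"
      using that by (simp add: off_def)
    then show ?thesis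
    proof (induction rule: rtranclp_induct)
      case (step y z)
      then have "y \<in> off x" "z \<in> off x"
        by (auto simp: off_def intro: rtranclp.rtrancl_into_rtrancl)
      with step show ?case
        by (auto intro: rtranclp.rtrancl_into_rtrancl)
    qed simp
  qed
  have "symp ?R\<^sup>*\<^sup>*"
    by (rule symp_rtranclp) (auto simp: symp_def sym)
  then have "?R\<^sup>*\<^sup>* d d'"
    using reach[OF assms(1)] reach[OF assms(2)] by (meson rtranclp_trans sympD)
  from rtranclp_imp_path[OF this]
  obtain ps where ps: "ps \<noteq> []" "distinct ps" "successively ?R ps" "hd ps = d" "last ps = d'"
    by (elim exE conjE)
  \<comment> \<open>A vertex of \<open>ps\<close> is either its last one, \<open>d'\<close>, or the
    source of an \<open>?R\<close> step; the path may be a single vertex.\<close>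
  have "set ps \<subseteq> off x"
  proof
    fix p assume "p \<in> set ps"
    then obtain us vs where split: "ps = us @ p # vs"
      by (meson split_list)
    then show "p \<in> off x"
      using ps assms by (cases vs) (auto simp: successively_append_iff)
  qed
  moreover have "successively E ps"
    using ps(3) by (rule successively_mono) auto
  ultimately show thesis
    using that ps by blast
qed

lemma attach_path:
  assumes "x \<notin> set cs" "a \<in> attach x" "b \<in> attach x"
  obtains ps where "ps \<noteq> []" "distinct ps" "successively E ps" "set ps \<inter> set cs = {}"
    "E a (hd ps)" "E (last ps) b"
proof -
  obtain d d' where d: "d \<in> off x" "E a d" "d' \<in> off x" "E b d'"
    using assms by (auto simp: attach_def)
  obtain ps where "ps \<noteq> []" "distinct ps" "successively E ps" "hd ps = d" "last ps = d'"
    "set ps \<subseteq> off x"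
    using off_path[OF d(1,3)] by metis
  then show thesis
    using that d sym off_disjoint[OF assms(1)] by blast
qed

text \<open>Otherwise the edge from \<open>cs ! i\<close> to its successor could be replaced by a
  detour through \<open>off x\<close>.\<close>

lemma successor_not_attached:
  assumes x: "x \<notin> set cs" and i: "i < length cs" "cs ! i \<in> attach x"
  shows "cs ! (Suc i mod length cs) \<notin> attach x"
proof
  let ?r = "rotate (Suc i) cs"
  assume "cs ! (Suc i mod length cs) \<in> attach x"
  then obtain ps where ps: "ps \<noteq> []" "distinct ps" "successively E ps" "set ps \<inter> set cs = {}"
    "E (cs ! i) (hd ps)" "E (last ps) (cs ! (Suc i mod length cs))"
    using attach_path[OF x i(2)] by metis
  have "vertex_cycle E ?r"
    using cycle by (rule vertex_cycle_rotate)
  then show False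
    using ps by (intro no_longer_cycle[of ?r ps])
      (auto simp: vertex_cycle_def last_hd_rotate_Suc[OF i(1)] simp del: rotate_Suc)
qed

text \<open>Otherwise a longer cycle runs from \<open>cs ! j\<close> backwards to the successor of
  \<open>cs ! i\<close>, across the assumed edge to the successor of \<open>cs ! j\<close>, forwards
  to \<open>cs ! i\<close>, and through \<open>off x\<close> back to \<open>cs ! j\<close>.\<close>

lemma successors_not_adjacent:
  assumes x: "x \<notin> set cs"
    and i: "i < length cs" "cs ! i \<in> attach x"
    and j: "j < length cs" "cs ! j \<in> attach x" and ne: "i \<noteq> j"
  shows "\<not> E (cs ! (Suc i mod length cs)) (cs ! (Suc j mod length cs))"
proof
  let ?r = "rotate (Suc i) cs"
  assume adj: "E (cs ! (Suc i mod length cs)) (cs ! (Suc j mod length cs))"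
  obtain ps where ps: "ps \<noteq> []" "distinct ps" "successively E ps" "set ps \<inter> set cs = {}"
    "E (cs ! i) (hd ps)" "E (last ps) (cs ! j)"
    using attach_path[OF x i(2) j(2)] by metis
  have r: "vertex_cycle E ?r"
    using cycle by (rule vertex_cycle_rotate)
  have "distinct cs"
    using cycle by (simp add: vertex_cycle_def)
  from rotate_split_at[OF this i(1) j(1) ne]
  obtain ys zs where yz: "?r = ys @ zs" "ys \<noteq> []" "zs \<noteq> []"
    "last ys = cs ! j" "hd zs = cs ! (Suc j mod length cs)"
    by metis
  have "hd ys = cs ! (Suc i mod length cs)" "last zs = cs ! i"
    using last_hd_rotate_Suc[OF i(1)] yz by auto
  moreover have "successively E (rev ys)"
    using r yz by (auto simp: vertex_cycle_def successively_append_iff successively_rev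
        intro: successively_mono sym)
  moreover have "set ys \<union> set zs = set cs" "length ys + length zs = length cs"
    using yz(1) by (metis set_append set_rotate, metis length_append length_rotate)
  moreover have "distinct (ys @ zs)" "successively E zs"
    using r unfolding yz(1) vertex_cycle_def successively_append_iff by blast+
  ultimately show False
    using ps yz adj by (intro no_longer_cycle[of "rev ys @ zs" ps])
      (auto simp: successively_append_iff hd_rev last_rev)
qed

lemma independent_beyond_cycle:
  assumes x: "x \<notin> set cs"
  obtains I where "I \<subseteq> insert x (set cs)" "card I = Suc (card (attach x))"
    "pairwise (\<lambda>u v. \<not> E u v) I"
proof -
  let ?s = "\<lambda>i. cs ! (Suc i mod length cs)"
  define J where "J = {i. i < length cs \<and> cs ! i \<in> attach x}"
  have dist: "distinct cs" and pos: "length cs > 0"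
    using cycle by (auto simp: vertex_cycle_def)
  have att: "attach x = (!) cs ` J"
    by (auto simp: J_def attach_def in_set_conv_nth image_iff)
  have "inj_on ((!) cs) J"
    using dist by (auto simp: J_def inj_on_def nth_eq_iff_index_eq)
  then have card_att: "card (attach x) = card J"
    by (simp add: att card_image)
  have "inj_on ?s J"
  proof (rule inj_onI)
    fix i j assume ij: "i \<in> J" "j \<in> J" "?s i = ?s j"
    then have "Suc i mod length cs = Suc j mod length cs"
      using dist pos by (subst (asm) nth_eq_iff_index_eq) auto
    then show "i = j"
      using inj_on_Suc_mod[of "length cs"] ij by (auto simp: inj_on_def J_def)
  qed
  then have card_s: "card (?s ` J) = card J"
    by (rule card_image)
  have sub: "?s ` J \<subseteq> set cs"
    using pos by auto
  have "x \<notin> ?s ` J" "finite J"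
    using sub x by (auto simp: J_def)
  then have "card (insert x (?s ` J)) = Suc (card (attach x))"
    by (simp add: card_s card_att)
  \<comment> \<open>As \<open>x\<close> lies in \<open>off x\<close>, a successor adjacent to
    \<open>x\<close> would be attached.\<close>
  moreover have "\<not> E (?s i) x" if "i \<in> J" for i
    using successor_not_attached[OF x, of i] that sub start_in_off[of x]
    by (auto simp: attach_def J_def)
  then have "pairwise (\<lambda>u v. \<not> E u v) (insert x (?s ` J))"
    using successors_not_adjacent[OF x] sym
    by (auto simp: pairwise_def J_def) metis+
  ultimately show thesis
    using that[of "insert x (?s ` J)"] sub by auto
qed

text \<open>The first vertex of \<open>cs\<close> entered from \<open>off x\<close> would belong to
  \<open>attach x\<close>, so a walk avoiding \<open>attach x\<close> never leaves
  \<open>off x\<close>.\<close>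

lemma attach_separates:
  assumes "x \<notin> set cs" "y \<in> set cs" "(\<lambda>u v. E u v \<and> v \<notin> attach x)\<^sup>*\<^sup>* x y"
  shows False
proof -
  have "y \<in> off x"
    using assms(3)
  proof (induction rule: rtranclp_induct)
    case (step u v)
    then show ?case
      using off_step[of u x v] sym by (auto simp: attach_def)
  qed (rule start_in_off)
  then show False
    using off_disjoint[OF assms(1)] assms(2) by blast
qed

end

section \<open>Ordered graphs\<close>

lemma set_mono_subseq: "subseq xs ys \<Longrightarrow> set xs \<subseteq> set ys"
  by (induction rule: list_emb.induct) auto

text \<open>No rotation occurs here because a rotated vertex cycle is again one, so \<open>q\<close>
  absorbs it.\<close>

definition vertex_ordered :: "nat \<Rightarrow> 'a set \<Rightarrow> ('a \<Rightarrow> 'a \<Rightarrow> bool) \<Rightarrow> bool" where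
  "vertex_ordered k V E \<longleftrightarrow>
     (\<forall>vs. length vs = k \<and> distinct vs \<and> set vs \<subseteq> V \<longrightarrow> (\<exists>q. vertex_cycle E q \<and> subseq vs q))"

lemma vertex_ordered_connected:
  assumes ord: "vertex_ordered k V E" and "finite V" "2 \<le> k" "k \<le> card V"
    and xy: "x \<in> V" "y \<in> V" "x \<noteq> y"
    and A: "A \<subseteq> V - {x, y}" "card A \<le> k - 2"
  shows "(\<lambda>u v. E u v \<and> v \<notin> A)\<^sup>*\<^sup>* x y"
proof -
  have "card (V - {x, y}) = card V - 2"
    using xy by (simp add: card_Diff_subset)
  \<comment> \<open>Orderedness concerns exactly \<open>k\<close> vertices, so \<open>A\<close> is
    padded to \<open>k - 2\<close> vertices besides \<open>x\<close> and \<open>y\<close>.\<close>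
  then obtain B where B: "A \<subseteq> B" "B \<subseteq> V - {x, y}" "card B = k - 2"
    using exists_subset_between[of A "k - 2" "V - {x, y}"] A \<open>finite V\<close> \<open>k \<le> card V\<close>
    by (metis diff_le_mono finite_Diff)
  then obtain bs where bs: "set bs = B" "distinct bs"
    using \<open>finite V\<close> finite_distinct_list by (metis finite_Diff finite_subset)
  have "length (x # y # bs) = k" "distinct (x # y # bs)" "set (x # y # bs) \<subseteq> V"
    using bs B xy \<open>2 \<le> k\<close> distinct_card[of bs] by auto
  then obtain q where q: "vertex_cycle E q" "subseq (x # y # bs) q"
    using ord unfolding vertex_ordered_def by blast
  obtain us ws where 1: "q = us @ x # ws" "subseq (y # bs) ws"
    using list_emb_ConsD[OF q(2)] by blast
  obtain vs zs where 2: "ws = vs @ y # zs" "subseq bs zs"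
    using list_emb_ConsD[OF 1(2)] by blast
  have q': "q = us @ (x # vs @ [y]) @ zs"
    by (simp add: 1 2)
  \<comment> \<open>All of \<open>A\<close> occurs after \<open>y\<close> in the distinct list
    \<open>q\<close>, hence not between \<open>x\<close> and \<open>y\<close>.\<close>
  have "set (vs @ [y]) \<inter> set zs = {}"
    using q(1) unfolding q' vertex_cycle_def by auto
  moreover have "A \<subseteq> set zs"
    using B bs set_mono_subseq[OF 2(2)] by blast
  ultimately have disj: "set (vs @ [y]) \<inter> A = {}"
    by blast
  have "successively E (x # vs @ [y])"
    using q(1) unfolding q' vertex_cycle_def successively_append_iff by blast
  moreover have "successively (\<lambda>u v. E u v \<and> v \<notin> A) (x # vs)"
    if "successively E (x # vs)" "set vs \<inter> A = {}" for x vs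
    using that by (induction vs arbitrary: x) auto
  ultimately have "successively (\<lambda>u v. E u v \<and> v \<notin> A) (x # vs @ [y])"
    using disj by blast
  from successively_imp_rtranclp[OF this] show ?thesis
    by simp
qed

lemma vertex_ordered_independent:
  assumes ord: "vertex_ordered k V E"
    and I: "I \<subseteq> V" "finite I" "k \<le> card I" "pairwise (\<lambda>u v. \<not> E u v) I"
  obtains q where "vertex_cycle E q" "2 * k \<le> length q"
proof -
  obtain J where J: "J \<subseteq> I" "card J = k" "finite J"
    using obtain_subset_with_card_n[OF I(3)] by metis
  then obtain vs where vs: "set vs = J" "distinct vs"
    using finite_distinct_list by blast
  then obtain q where q: "vertex_cycle E q" "subseq vs q"
    using ord J I distinct_card[of vs] unfolding vertex_ordered_def by (metis subset_trans)
  then have "set vs \<subseteq> set q"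
    by (metis set_mono_subseq)
  then have "2 * card J \<le> length q"
    using independent_in_vertex_cycle[OF q(1)] pairwise_subset[OF I(4) J(1)] vs by simp
  with q J that show thesis
    by simp
qed

lemma (in longest_cycle) vertex_ordered_length:
  assumes ord: "vertex_ordered k V E" and V: "finite V" "2 \<le> k" "k \<le> card V" "set cs \<subseteq> V"
  shows "min (card V) (2 * k) \<le> length cs"
proof (cases "set cs = V")
  case True
  then show ?thesis
    using cycle distinct_card[of cs] by (auto simp: vertex_cycle_def)
next
  case False
  then obtain x where x: "x \<in> V" "x \<notin> set cs"
    using V by blast
  have att: "attach x \<subseteq> set cs"
    by (auto simp: attach_def)
  have pos: "0 < length cs"
    using cycle by (auto simp: vertex_cycle_def)
  \<comment> \<open>Either the successor of \<open>cs ! 0\<close> or \<open>cs ! 0\<close> itself is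
    unattached.\<close>
  obtain y where y: "y \<in> set cs" "y \<notin> attach x"
    using successor_not_attached[OF x(2) pos] pos
    by (metis mod_less_divisor nth_mem)
  have "k - 1 \<le> card (attach x)"
  proof (rule ccontr)
    assume "\<not> k - 1 \<le> card (attach x)"
    then have "card (attach x) \<le> k - 2"
      by simp
    moreover have "attach x \<subseteq> V - {x, y}"
      using att V x y by auto
    moreover have "y \<in> V" "x \<noteq> y"
      using x y V by auto
    ultimately have "(\<lambda>u v. E u v \<and> v \<notin> attach x)\<^sup>*\<^sup>* x y"
      using vertex_ordered_connected[OF ord V(1-3) x(1)] by blast
    then show False
      using attach_separates x(2) y(1) by blast
  qed
  obtain I where I: "I \<subseteq> insert x (set cs)" "card I = Suc (card (attach x))"
    "pairwise (\<lambda>u v. \<not> E u v) I"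
    using independent_beyond_cycle[OF x(2)] by metis
  \<comment> \<open>The vertex \<open>x\<close> raises the \<open>k - 1\<close> successors to
    \<open>k\<close> independent vertices.\<close>
  have "I \<subseteq> V" "finite I" "k \<le> card I"
    using I x V \<open>k - 1 \<le> card (attach x)\<close> by (auto intro: finite_subset)
  then obtain q where "vertex_cycle E q" "2 * k \<le> length q"
    using vertex_ordered_independent[OF ord _ _ _ I(3)] by metis
  then show ?thesis
    using longest[of q] by simp
qed

section \<open>Arc cycles and vertex cycles\<close>

text \<open>The claim on \<open>hd\<close> strengthens the induction: it identifies the head of the
  current arc with the first vertex of the remaining walk.\<close>

lemma pcas_imp_successively:
  assumes "pcas u p v" "set p \<subseteq> parcs G"
  shows "successively (\<lambda>u v. (u, v) \<in> parcs G) (map fst p @ [v]) \<and> hd (map fst p @ [v]) = u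
    \<and> pawalk_verts u p = map fst p @ [v]"
  using assms
proof (induction u p v rule: pcas.induct)
  case (2 u e es v)
  then show ?case
    by (cases e; cases es) auto
qed simp

lemma successively_imp_pcas:
  assumes "successively (\<lambda>u v. (u, v) \<in> parcs G) (xs @ [v])"
  shows "\<exists>p. pcas (hd (xs @ [v])) p v \<and> set p \<subseteq> parcs G \<and> map fst p = xs"
  using assms
proof (induction xs)
  case (Cons x xs)
  then obtain p where p: "pcas (hd (xs @ [v])) p v" "set p \<subseteq> parcs G" "map fst p = xs"
    by (auto simp: successively_Cons)
  with Cons.prems show ?case
    by (intro exI[of _ "(x, hd (xs @ [v])) # p"]) (auto simp: successively_Cons)
qed simp

context pair_graph
begin

lemma graph_cycle_imp_vertex_cycle:
  assumes "graph_cycle G p"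
  shows "vertex_cycle (\<lambda>u v. (u, v) \<in> parcs G) (map fst p)" "fst ` set p \<subseteq> pverts G"
proof -
  obtain u where u: "awalk u p u" "distinct (tl (pawalk_verts u p))" "3 \<le> length p"
    using assms by (auto simp: graph_cycle_def cycle_def)
  then have p: "pcas u p u" "set p \<subseteq> parcs G"
    by (auto simp: awalk_def)
  show "fst ` set p \<subseteq> pverts G"
    using p(2) arc_fst_in_verts by blast
  note * = pcas_imp_successively[OF p]
  have ne: "p \<noteq> []"
    using u by auto
  with * have hd: "hd (map fst p) = u"
    by (cases p) auto
  \<comment> \<open>The library drops the first occurrence of the base point and keeps the last;
    moving \<open>u\<close> to the front gives \<open>map fst p\<close>.\<close>
  have "distinct (tl (map fst p) @ [u])"
    using * u ne by simp
  then have "distinct (map fst p)"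
    using hd ne by (cases p) auto
  then show "vertex_cycle (\<lambda>u v. (u, v) \<in> parcs G) (map fst p)"
    using * hd u ne by (auto simp: vertex_cycle_def successively_append_iff)
qed

lemma vertex_cycle_imp_graph_cycle:
  assumes "vertex_cycle (\<lambda>u v. (u, v) \<in> parcs G) xs"
  shows "\<exists>p. graph_cycle G p \<and> map fst p = xs"
proof -
  have ne: "xs \<noteq> []"
    using assms by (auto simp: vertex_cycle_def)
  have "successively (\<lambda>u v. (u, v) \<in> parcs G) (xs @ [hd xs])"
    using assms by (auto simp: vertex_cycle_def successively_append_iff)
  from successively_imp_pcas[OF this] ne
  obtain p where p: "pcas (hd xs) p (hd xs)" "set p \<subseteq> parcs G" "map fst p = xs"
    by auto
  \<comment> \<open>\<open>awalk\<close> requires its start to be a vertex of the graph; the closing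
    arc shows this.\<close>
  have "(last xs, hd xs) \<in> parcs G"
    using assms by (simp add: vertex_cycle_def)
  then have "awalk (hd xs) p (hd xs)"
    using p in_arcsD2 by (auto simp: awalk_def)
  moreover have "pawalk_verts (hd xs) p = xs @ [hd xs]"
    using pcas_imp_successively[OF p(1,2)] p(3) by simp
  then have "distinct (tl (pawalk_verts (hd xs) p))"
    using assms ne by (cases xs) (auto simp: vertex_cycle_def)
  moreover have "length p = length xs"
    using p(3) by auto
  ultimately have "graph_cycle G p"
    using assms by (auto simp: graph_cycle_def cycle_def vertex_cycle_def)
  with p show ?thesis
    by blast
qed

end

theorem theorem2:
  fixes G :: "'a pair_pre_digraph" and n k :: nat
  assumes "pair_graph G"
    and "n = card (pverts G)"
    and "2 \<le> k" and "k \<le> n"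
    and "k_ordered k G"
  shows "circumference G \<ge> min n (2 * k)"
proof -
  interpret pair_graph G by fact
  let ?E = "\<lambda>u v. (u, v) \<in> parcs G" and ?S = "{length p | p. graph_cycle G p}"
  have fin: "finite ?S"
    using assms(1) by (rule finite_graph_cycle_lengths)
  have ord: "vertex_ordered k (pverts G) ?E"
    unfolding vertex_ordered_def
  proof (intro allI impI)
    fix vs assume "length vs = k \<and> distinct vs \<and> set vs \<subseteq> pverts G"
    then obtain p m where "graph_cycle G p" "subseq vs (rotate m (map fst p))"
      using \<open>k_ordered k G\<close> by (auto simp: k_ordered_def visits_in_cyclic_order_def)
    then show "\<exists>q. vertex_cycle ?E q \<and> subseq vs q"
      using graph_cycle_imp_vertex_cycle vertex_cycle_rotate by blast
  qed
  \<comment> \<open>Since \<open>k \<le> n\<close>, some sequence of \<open>k\<close> distinct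
    vertices exists. Hence there is a cycle, and the maximum defining \<open>circumference G\<close>
    is attained.\<close>
  obtain W where "W \<subseteq> pverts G" "card W = k" "finite W"
    using obtain_subset_with_card_n assms by metis
  then obtain vs where "set vs = W" "distinct vs" "length vs = k"
    using finite_distinct_list distinct_card by metis
  then obtain q where "graph_cycle G q"
    using \<open>k_ordered k G\<close> \<open>W \<subseteq> pverts G\<close> by (auto simp: k_ordered_def)
  then have "?S \<noteq> {}"
    by blast
  then have "circumference G \<in> ?S"
    unfolding circumference_def using fin by (rule Max_in[rotated])
  then obtain p where p: "graph_cycle G p" "length p = circumference G"
    by auto
  interpret longest_cycle ?E "map fst p"
  proof
    show "(v, u) \<in> parcs G" if "(u, v) \<in> parcs G" for u v
      using that by (rule arcs_symmetric)
    show "vertex_cycle ?E (map fst p)"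
      using p(1) by (rule graph_cycle_imp_vertex_cycle)
    show "length ds \<le> length (map fst p)" if ds: "vertex_cycle ?E ds" for ds
    proof -
      obtain r where r: "graph_cycle G r" "map fst r = ds"
        using vertex_cycle_imp_graph_cycle[OF ds] by blast
      then have "length ds \<in> ?S"
        by auto
      then show ?thesis
        using fin p(2) by (simp add: circumference_def)
    qed
  qed
  show ?thesis
    using vertex_ordered_length[OF ord pair_finite_verts] assms p
      graph_cycle_imp_vertex_cycle(2)[OF p(1)] by simp
qed

end
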